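(* Let $G$ be an integrally weighted plumbing tree with vertices $v_1,\dots,v_\ell$ and let $Y(G)$ be the associated plumbed 3-manifold. For $\gamma=a_1\mu_1+\cdots+a_\ell\mu_\ell$ with $a_i\in\mathbb{Z}$, let $\mathfrak{A}_\gamma=a_1\mathfrak{A}_{\mu_1}+\cdots+a_\ell\mathfrak{A}_{\mu_\ell}$ be the endomorphism of the lattice complex $\mathbb{CF}(G)$ determined by $$\mathfrak{A}_{\mu_i}([K,E])=\begin{cases}U^{a_{v_i}(K,E)}\otimes[K,E\setminus\{v_i\}] & v_i\in E,\\ 0& v_i\notin E,\end{cases}$$ extended equivariantly over $U$. Then, up to chain homotopy, $\mathfrak{A}_\gamma$ depends only on the class of $\gamma$ in $H_1(Y(G))/\mathrm{Tors}$.
   Context: $\mathbb{F}=\mathbb{Z}/2$. For an integrally weighted tree $G$ with vertex set $V=\{v_1,\dots,v_\ell\}$, $X(G)$ is the 4-manifold obtained by plumbing disk bundles over $S^2$ according to $G$ and $Y(G)=\partial X(G)$. $H_2(X(G))$ is free on $V$ with intersection form: $v\cdot v$ is the weight of $v$; for $v\neq w$, $v\cdot w=1$ if $v,w$ are adjacent and $0$ otherwise. $Y(G)$ is integral surgery on a link $L_G\subset S^3$ with one unknotted component $K_i$ for each vertex $v_i$ (and a clasp for each edge), framed by the weights; $\mu_i$ is the meridian of $K_i$. With $\Lambda$ the framing (linking) matrix, $H_1(Y(G))\cong\mathbb{Z}^\ell/\operatorname{im}\Lambda$, where $\mathbb{Z}^\ell$ is free on $\mu_1,\dots,\mu_\ell$.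 $\mathrm{Char}(G)$ is the set of $K\in H^2(X(G))$ with $K(\Sigma)+\Sigma^2\equiv 0\pmod 2$ for all $\Sigma\in H_2(X(G))$. For $v\in V$, $v^*(w)=v\cdot w$. For $I\subseteq V$, $2f(K,I)=\sum_{v\in I}K(v)+(\sum_{v\in I}v)^2$; for $E\subseteq V$, $g(K,E)=\min_{I\subseteq E}f(K,I)$; for $v\in E$, $a_v(K,E)=g(K,E\setminus\{v\})-g(K,E)$ and $b_v(K,E)=\min\{f(K,I):v\in I\subseteq E\}-g(K,E)$. The lattice complex is $\mathbb{CF}(G)=\prod_{K\in\mathrm{Char}(G),E\subseteq V}\mathbb{F}[[U]]\otimes\langle[K,E]\rangle$ with differential $$\partial[K,E]=\sum_{v\in E}U^{a_v(K,E)}\otimes[K,E\setminus\{v\}]+\sum_{v\in E}U^{b_v(K,E)}\otimes[K+2v^*,E\setminus\{v\}],$$ extended $U$-equivariantly and to infinite sums. (The map $\mathfrak{A}_{\mu_i}$ is one of the terms of $\partial$.) *)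

theory Defs
  imports
    "HOL-Analysis.Analysis"
    "HOL-Algebra.Coset"
    "HOL-Library.Function_Algebras"
    "HOL-Library.Z2"
begin

unbundle no fps_syntax

section \<open>Weighted trees and the intersection lattice\<close>

text \<open>The vertex set of a graph is the whole of the finite type \<open>'v\<close>.\<close>

record 'v weighted_graph =
  adjacent :: "'v \<Rightarrow> 'v \<Rightarrow> bool"
  weight :: "'v \<Rightarrow> int"

definition weighted_tree :: "'v::finite weighted_graph \<Rightarrow> bool" where
  "weighted_tree G \<longleftrightarrow>
     symp (adjacent G) \<and> irreflp (adjacent G) \<and>
     (\<forall>v w. (adjacent G)\<^sup>*\<^sup>* v w) \<and>
     \<not> (\<exists>c. 3 \<le> length c \<and> distinct c \<and> successively (adjacent G) c \<and>
           adjacent G (last c) (hd c))"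

text \<open>
  Both \<open>H\<^sub>2(X(G))\<close> (basis the vertices) and \<open>H\<^sup>2(X(G)) = Hom(H\<^sub>2(X(G)), \<int>)\<close> (dual basis)
  are written as \<open>int ^ 'v\<close>. The matrix below is at once the matrix of the intersection
  form of \<open>X(G)\<close> and the framing matrix of the link \<open>L\<^sub>G\<close>.
\<close>

definition framing_matrix :: "'v::finite weighted_graph \<Rightarrow> int ^ 'v ^ 'v" where
  "framing_matrix G =
     (\<chi> v w. if v = w then weight G v else if adjacent G v w then 1 else 0)"

definition intersection :: "'v::finite weighted_graph \<Rightarrow> int ^ 'v \<Rightarrow> int ^ 'v \<Rightarrow> int" where
  "intersection G S T = (\<Sum>v\<in>UNIV. \<Sum>w\<in>UNIV. S $ v * T $ w * framing_matrix G $ v $ w)"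

definition evaluate :: "int ^ 'v \<Rightarrow> int ^ 'v::finite \<Rightarrow> int" where
  "evaluate K S = (\<Sum>v\<in>UNIV. K $ v * S $ v)"

definition vertex_dual :: "'v::finite weighted_graph \<Rightarrow> 'v \<Rightarrow> int ^ 'v" where
  "vertex_dual G v = (\<chi> w. intersection G (axis v 1) (axis w 1))"

definition Char :: "'v::finite weighted_graph \<Rightarrow> (int ^ 'v) set" where
  "Char G = {K. \<forall>S. even (evaluate K S + intersection G S S)}"

section \<open>The lattice complex\<close>

definition vertex_sum :: "'v set \<Rightarrow> int ^ 'v::finite" where
  "vertex_sum I = (\<Sum>v\<in>I. axis v 1)"

text \<open>The division is exact for \<open>K \<in> Char G\<close>, the only case that matters.\<close>

definition f_wt :: "'v::finite weighted_graph \<Rightarrow> int ^ 'v \<Rightarrow> 'v set \<Rightarrow> int" where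
  "f_wt G K I =
     ((\<Sum>v\<in>I. K $ v) + intersection G (vertex_sum I) (vertex_sum I)) div 2"

definition g_wt :: "'v::finite weighted_graph \<Rightarrow> int ^ 'v \<Rightarrow> 'v set \<Rightarrow> int" where
  "g_wt G K E = Min (f_wt G K ` {I. I \<subseteq> E})"

text \<open>For \<open>v \<in> E\<close> both exponents are nonnegative, so \<^const>\<open>nat\<close> does not truncate.\<close>

definition a_exp :: "'v::finite weighted_graph \<Rightarrow> 'v \<Rightarrow> int ^ 'v \<Rightarrow> 'v set \<Rightarrow> nat" where
  "a_exp G v K E = nat (g_wt G K (E - {v}) - g_wt G K E)"

definition b_exp :: "'v::finite weighted_graph \<Rightarrow> 'v \<Rightarrow> int ^ 'v \<Rightarrow> 'v set \<Rightarrow> nat" where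
  "b_exp G v K E = nat (Min (f_wt G K ` {I. v \<in> I \<and> I \<subseteq> E}) - g_wt G K E)"

text \<open>
  A chain assigns a coefficient in \<open>\<F>[[U]]\<close>, where \<open>\<F> = \<int>/2\<close>, to each \<open>[K, E]\<close>. An element of
  the direct product over \<open>Char(G)\<close> is a chain that vanishes off \<open>Char(G)\<close>.
\<close>

type_synonym 'v chain = "(int ^ 'v) \<times> 'v set \<Rightarrow> bit fps"

definition CF :: "'v::finite weighted_graph \<Rightarrow> 'v chain set" where
  "CF G = {x. \<forall>K E. K \<notin> Char G \<longrightarrow> x (K, E) = 0}"

definition scale :: "bit fps \<Rightarrow> 'v::finite chain \<Rightarrow> 'v chain" where
  "scale c x = (\<lambda>p. c * x p)"

definition generator :: "int ^ 'v \<Rightarrow> 'v set \<Rightarrow> 'v::finite chain" where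
  "generator K E = (\<lambda>p. if p = (K, E) then 1 else 0)"

text \<open>
  Extension of a map given on generators, \<open>U\<close>-equivariantly and to infinite sums. It is meaningful
  if each generator occurs in \<open>\<phi> K E\<close> for only finitely many \<open>(K, E)\<close>; this holds for
  the maps below.
\<close>

definition extend :: "(int ^ 'v \<Rightarrow> 'v set \<Rightarrow> 'v chain) \<Rightarrow> 'v::finite chain \<Rightarrow> 'v chain" where
  "extend \<phi> x = (\<lambda>p. \<Sum>(K, E) | \<phi> K E p \<noteq> 0. x (K, E) * \<phi> K E p)"

definition differential :: "'v::finite weighted_graph \<Rightarrow> 'v chain \<Rightarrow> 'v chain" where
  "differential G = extend (\<lambda>K E.
     (\<Sum>v\<in>E. scale (fps_X ^ a_exp G v K E) (generator K (E - {v}))) +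
     (\<Sum>v\<in>E. scale (fps_X ^ b_exp G v K E) (generator (K + 2 *s vertex_dual G v) (E - {v}))))"

definition meridian_action :: "'v::finite weighted_graph \<Rightarrow> 'v \<Rightarrow> 'v chain \<Rightarrow> 'v chain" where
  "meridian_action G v = extend (\<lambda>K E.
     if v \<in> E then scale (fps_X ^ a_exp G v K E) (generator K (E - {v})) else 0)"

definition homology_action :: "'v::finite weighted_graph \<Rightarrow> int ^ 'v \<Rightarrow> 'v chain \<Rightarrow> 'v chain" where
  "homology_action G \<gamma> x = (\<Sum>v\<in>UNIV. scale (of_int (\<gamma> $ v)) (meridian_action G v x))"

section \<open>Chain homotopy\<close>

text \<open>
  Compatibility with infinite sums is continuity for the product topology on
  functions, each factor \<open>\<F>[[U]]\<close> carrying its \<open>U\<close>-adic topology (the metric of \<^typ>\<open>bit fps\<close>).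
\<close>

definition CF_endomorphism ::
    "'v::finite weighted_graph \<Rightarrow> ('v chain \<Rightarrow> 'v chain) \<Rightarrow> bool" where
  "CF_endomorphism G \<Phi> \<longleftrightarrow>
     \<Phi> ` CF G \<subseteq> CF G \<and>
     (\<forall>x\<in>CF G. \<forall>y\<in>CF G. \<Phi> (x + y) = \<Phi> x + \<Phi> y) \<and>
     (\<forall>c. \<forall>x\<in>CF G. \<Phi> (scale c x) = scale c (\<Phi> x)) \<and>
     continuous_on (CF G) \<Phi>"

definition chain_map ::
    "'v::finite weighted_graph \<Rightarrow> ('v chain \<Rightarrow> 'v chain) \<Rightarrow> bool" where
  "chain_map G \<Phi> \<longleftrightarrow>
     CF_endomorphism G \<Phi> \<and> (\<forall>x\<in>CF G. differential G (\<Phi> x) = \<Phi> (differential G x))"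

definition chain_homotopic ::
    "'v::finite weighted_graph \<Rightarrow> ('v chain \<Rightarrow> 'v chain) \<Rightarrow> ('v chain \<Rightarrow> 'v chain) \<Rightarrow> bool" where
  "chain_homotopic G \<Phi> \<Psi> \<longleftrightarrow>
     chain_map G \<Phi> \<and> chain_map G \<Psi> \<and>
     (\<exists>H. CF_endomorphism G H \<and>
       (\<forall>x\<in>CF G. \<Phi> x - \<Psi> x = differential G (H x) + H (differential G x)))"

section \<open>First homology of the plumbed manifold\<close>

definition meridian_group :: "(int ^ 'v::finite) monoid" where
  "meridian_group = \<lparr>carrier = UNIV, mult = (+), one = 0\<rparr>"

definition relations :: "'v::finite weighted_graph \<Rightarrow> (int ^ 'v) set" where
  "relations G = range ((*v) (framing_matrix G))"

definition H1 :: "'v::finite weighted_graph \<Rightarrow> (int ^ 'v) set monoid" where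
  "H1 G = meridian_group Mod relations G"

definition torsion :: "('a, 'b) monoid_scheme \<Rightarrow> 'a set" where
  "torsion A = {x \<in> carrier A. \<exists>n::nat. 0 < n \<and> x [^]\<^bsub>A\<^esub> n = \<one>\<^bsub>A\<^esub>}"

definition H1_mod_torsion :: "'v::finite weighted_graph \<Rightarrow> (int ^ 'v) set set monoid" where
  "H1_mod_torsion G = H1 G Mod torsion (H1 G)"

text \<open>The class in \<^term>\<open>H1_mod_torsion G\<close> of \<open>\<gamma> = \<Sum>\<^sub>i a\<^sub>i \<mu>\<^sub>i\<close>, given by its coefficient vector.\<close>

definition H1_mod_torsion_class :: "'v::finite weighted_graph \<Rightarrow> int ^ 'v \<Rightarrow> (int ^ 'v) set set" where
  "H1_mod_torsion_class G \<gamma> =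
     torsion (H1 G) #>\<^bsub>H1 G\<^esub> (relations G #>\<^bsub>meridian_group\<^esub> \<gamma>)"

end

theory Submission
  imports Defs
begin

text \<open>
  Write \<open>A\<^sub>v\<close> for the action of the meridian of \<open>v\<close> and \<open>B\<^sub>v\<close> for the other term of the
  differential at \<open>v\<close>, the one that moves \<open>K\<close> to \<open>K + 2v\<^sup>*\<close>. The differential is the sum of all
  \<open>A\<^sub>v + B\<^sub>v\<close>.

  Every action is a chain map because \<open>A\<^sub>v\<close> commutes with each \<open>A\<^sub>w\<close> and each \<open>B\<^sub>w\<close>. Only the powers
  of \<open>U\<close> have to be compared. Removing \<open>v\<close> and \<open>w\<close> by \<open>A\<close>-terms costs
  \<open>g(K, E - {v, w}) - g(K, E)\<close> in either order. For \<open>A\<^sub>v\<close> and \<open>B\<^sub>w\<close> the identity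
  \<open>f(K, J \<union> {w}) = f(K + 2w\<^sup>*, J) + f(K, {w})\<close> turns \<open>b\<^sub>w\<close> into a difference of values of \<open>g\<close>
  up to the constant \<open>f(K, {w})\<close>, and the sums telescope again (\<open>a_exp_b_exp_commute\<close>).

  For the homotopy, put \<open>\<delta> = \<gamma> - \<gamma>'\<close> and let \<open>H\<close> multiply \<open>[K, E]\<close> by an integer \<open>h(K, E)\<close>
  reduced mod 2. Then \<open>\<partial>H + H\<partial>\<close> multiplies the \<open>A\<^sub>v\<close>-term by \<open>h(K, E) - h(K, E - {v})\<close> and the
  \<open>B\<^sub>v\<close>-term by \<open>h(K, E) - h(K + 2v\<^sup>*, E - {v})\<close>. These should be \<open>\<delta>\<^sub>v\<close> and \<open>0\<close>, which is achieved by
  \<open>h(K, E) = k(K) + \<Sum>\<^sub>v\<^sub>\<in>\<^sub>E \<delta>\<^sub>v\<close> as soon as \<open>k(K + 2v\<^sup>*) = k(K) + \<delta>\<^sub>v\<close>.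
  Such a potential \<open>k\<close> exists if and only if \<open>\<delta>\<close> vanishes on the kernel of the framing matrix
  (\<open>potential_exists\<close>), and this holds whenever some positive multiple of \<open>\<delta>\<close> lies in the image of
  that symmetric matrix. The integrality of \<open>k\<close> is essential: a homotopy for \<open>n\<delta>\<close> alone would
  say nothing about \<open>\<delta>\<close> over \<open>\<F>\<close> when \<open>n\<close> is even.
\<close>

section \<open>Arithmetic of the intersection form\<close>

lemma framing_matrix_symmetric:
  "weighted_tree G \<Longrightarrow> framing_matrix G $ v $ w = framing_matrix G $ w $ v"
  by (auto simp: weighted_tree_def framing_matrix_def dest: sympD)

lemma intersection_vertex_sum:
  "intersection G (vertex_sum I) (vertex_sum J) = (\<Sum>v\<in>I. \<Sum>w\<in>J. framing_matrix G $ v $ w)"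
proof -
  have "vertex_sum A $ v = of_bool (v \<in> A)" for A :: "'a set" and v
    by (simp add: vertex_sum_def axis_def sum.If_cases flip: of_bool_def)
  then have "intersection G (vertex_sum I) (vertex_sum J)
      = (\<Sum>v\<in>UNIV. of_bool (v \<in> I) * (\<Sum>w\<in>UNIV. of_bool (w \<in> J) * framing_matrix G $ v $ w))"
    by (simp only: intersection_def sum_distrib_left mult.assoc)
  then show ?thesis
    by (simp only: sum_of_bool_mult_eq[OF finite] Int_UNIV_left Collect_mem_eq)
qed

lemma vertex_dual_nth: "vertex_dual G v $ w = framing_matrix G $ v $ w"
  using intersection_vertex_sum[of G "{v}" "{w}"] by (simp add: vertex_dual_def vertex_sum_def)

lemma Char_add_vertex_dual: "K + 2 *s vertex_dual G v \<in> Char G \<longleftrightarrow> K \<in> Char G"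
proof -
  have "evaluate (K + 2 *s vertex_dual G v) S = evaluate K S + 2 * evaluate (vertex_dual G v) S" for S
    by (simp add: evaluate_def distrib_right sum.distrib sum_distrib_left mult.assoc)
  then show ?thesis
    by (simp add: Char_def)
qed

lemma Char_diff_vertex_dual: "K - 2 *s vertex_dual G v \<in> Char G \<longleftrightarrow> K \<in> Char G"
  using Char_add_vertex_dual[of "K - 2 *s vertex_dual G v" G v] by simp

section \<open>The weights\<close>

text \<open>
  Expanding \<open>(J + w)\<^sup>2 = J\<^sup>2 + 2 J \<cdot> w + w\<^sup>2\<close>, the cross term is absorbed by the shift of \<open>K\<close>.
  That \<open>K\<close> is characteristic makes \<open>K(w) + w\<^sup>2\<close> even, so that halving is additive here.
\<close>

lemma f_wt_insert:
  assumes G: "weighted_tree G" and K: "K \<in> Char G" and w: "w \<notin> J"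
  shows "f_wt G K (insert w J) = f_wt G (K + 2 *s vertex_dual G w) J + f_wt G K {w}"
proof -
  let ?L = "\<lambda>v u. framing_matrix G $ v $ u"
  have "evaluate K (vertex_sum {w}) = K $ w"
    by (simp add: evaluate_def vertex_sum_def axis_def if_distrib cong: if_cong)
  then have "even (K $ w + ?L w w)"
    using K by (auto simp: Char_def intersection_vertex_sum dest!: spec[of _ "vertex_sum {w}"])
  then obtain k where k: "K $ w + ?L w w = 2 * k" ..
  have "(\<Sum>v\<in>J. ?L v w) = (\<Sum>u\<in>J. ?L w u)"
    by (intro sum.cong refl framing_matrix_symmetric[OF G])
  then have "(\<Sum>v\<in>insert w J. \<Sum>u\<in>insert w J. ?L v u)
      = ?L w w + 2 * (\<Sum>u\<in>J. ?L w u) + (\<Sum>v\<in>J. \<Sum>u\<in>J. ?L v u)"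
    using w by (simp add: sum.distrib)
  moreover have "(\<Sum>v\<in>J. (K + 2 *s vertex_dual G w) $ v) = (\<Sum>v\<in>J. K $ v) + 2 * (\<Sum>u\<in>J. ?L w u)"
    by (simp add: sum.distrib sum_distrib_left vertex_dual_nth)
  ultimately have "(\<Sum>v\<in>insert w J. K $ v) + (\<Sum>v\<in>insert w J. \<Sum>u\<in>insert w J. ?L v u)
      = ((\<Sum>v\<in>J. (K + 2 *s vertex_dual G w) $ v) + (\<Sum>v\<in>J. \<Sum>u\<in>J. ?L v u)) + 2 * k"
    using w k by simp
  then show ?thesis
    using k by (simp add: f_wt_def intersection_vertex_sum)
qed

text \<open>
  Thanks to this formula both exponents are differences of values of \<open>g\<close>, up to a
  constant depending on \<open>K\<close> and \<open>w\<close> only, and exponents of composites telescope.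
\<close>

lemma Min_f_wt_containing:
  assumes "weighted_tree G" "K \<in> Char G" "w \<in> E"
  shows "Min (f_wt G K ` {I. w \<in> I \<and> I \<subseteq> E})
    = g_wt G (K + 2 *s vertex_dual G w) (E - {w}) + f_wt G K {w}"
proof -
  have "{I. w \<in> I \<and> I \<subseteq> E} = insert w ` {J. J \<subseteq> E - {w}}"
  proof (intro equalityI subsetI)
    fix I assume "I \<in> {I. w \<in> I \<and> I \<subseteq> E}"
    then show "I \<in> insert w ` {J. J \<subseteq> E - {w}}"
      by (intro image_eqI[of _ _ "I - {w}"]) auto
  qed (use assms in auto)
  then have "f_wt G K ` {I. w \<in> I \<and> I \<subseteq> E}
      = (\<lambda>J. f_wt G (K + 2 *s vertex_dual G w) J + f_wt G K {w}) ` {J. J \<subseteq> E - {w}}"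
    by (simp only: image_image) (intro image_cong f_wt_insert[OF assms(1,2)], auto)
  then show ?thesis
    using Min_add_commute[of "{J. J \<subseteq> E - {w}}" "f_wt G (K + 2 *s vertex_dual G w)" "f_wt G K {w}"]
    by (auto simp: g_wt_def)
qed

lemma g_wt_antimono: "E \<subseteq> F \<Longrightarrow> g_wt G K F \<le> g_wt G K E"
  unfolding g_wt_def by (rule Min_antimono) auto

lemma a_exp_of_nat: "int (a_exp G v K E) = g_wt G K (E - {v}) - g_wt G K E"
  by (simp add: a_exp_def g_wt_antimono)

lemma b_exp_of_nat:
  assumes "weighted_tree G" "K \<in> Char G" "w \<in> E"
  shows "int (b_exp G w K E)
    = g_wt G (K + 2 *s vertex_dual G w) (E - {w}) + f_wt G K {w} - g_wt G K E"
proof -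
  have "g_wt G K E \<le> Min (f_wt G K ` {I. w \<in> I \<and> I \<subseteq> E})"
    unfolding g_wt_def using assms(3) by (intro Min_antimono) auto
  then show ?thesis
    by (simp add: b_exp_def Min_f_wt_containing[OF assms])
qed

lemma a_exp_commute:
  "a_exp G v K (E - {w}) + a_exp G w K E = a_exp G w K (E - {v}) + a_exp G v K E"
proof -
  have "E - {w} - {v} = E - {v} - {w}" by blast
  then have "int (a_exp G v K (E - {w}) + a_exp G w K E) = int (a_exp G w K (E - {v}) + a_exp G v K E)"
    by (simp add: a_exp_of_nat)
  then show ?thesis by (simp only: of_nat_eq_iff)
qed

lemma a_exp_b_exp_commute:
  assumes "weighted_tree G" "K \<in> Char G" "w \<in> E" "v \<noteq> w"
  shows "a_exp G v (K + 2 *s vertex_dual G w) (E - {w}) + b_exp G w K E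
    = b_exp G w K (E - {v}) + a_exp G v K E"
proof -
  have "E - {w} - {v} = E - {v} - {w}" by blast
  then have "int (a_exp G v (K + 2 *s vertex_dual G w) (E - {w}) + b_exp G w K E)
      = int (b_exp G w K (E - {v}) + a_exp G v K E)"
    using assms by (simp add: a_exp_of_nat b_exp_of_nat)
  then show ?thesis by (simp only: of_nat_eq_iff)
qed

section \<open>Continuity of power series arithmetic\<close>

lemma continuous_on_fps_add:
  fixes f g :: "'a::topological_space \<Rightarrow> 'b::ab_group_add fps"
  assumes "continuous_on S f" "continuous_on S g"
  shows "continuous_on S (\<lambda>x. f x + g x)"
  unfolding continuous_on tendsto_iff
proof (intro ballI allI impI)
  fix x and e :: real assume x: "x \<in> S" and e: "e > 0"
  have dist_add: "dist (a + b) (c + d) \<le> dist a c + dist b d" for a b c d :: "'b fps"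
  proof -
    have "dist (a + b) (c + b) = dist a c" "dist (c + b) (c + d) = dist b d"
      by (simp_all add: dist_fps_def)
    then show ?thesis using dist_triangle[of "a + b" "c + d" "c + b"] by simp
  qed
  have "\<forall>\<^sub>F y in at x within S. dist (f y) (f x) < e / 2"
       "\<forall>\<^sub>F y in at x within S. dist (g y) (g x) < e / 2"
    using assms x half_gt_zero[OF e] unfolding continuous_on tendsto_iff by blast+
  then show "\<forall>\<^sub>F y in at x within S. dist (f y + g y) (f x + g x) < e"
  proof eventually_elim
    case (elim y)
    then show ?case using dist_add[of "f y" "g y" "f x" "g x"] by linarith
  qed
qed

lemma continuous_on_fps_mult_left:
  fixes f :: "'a::topological_space \<Rightarrow> 'b::idom fps"
  assumes "continuous_on S f"
  shows "continuous_on S (\<lambda>x. c * f x)"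
  unfolding continuous_on tendsto_iff
proof (intro ballI allI impI)
  fix x and e :: real assume x: "x \<in> S" and e: "e > 0"
  have dist_mult: "dist (c * a) (c * b) \<le> dist a b" for a b :: "'b fps"
  proof (cases "c = 0 \<or> a = b")
    case False
    then have "subdegree (a - b) \<le> subdegree (c * a - c * b)"
      by (simp flip: right_diff_distrib)
    with False show ?thesis by (simp add: dist_fps_def field_simps)
  qed (auto simp: dist_fps_def)
  have "\<forall>\<^sub>F y in at x within S. dist (f y) (f x) < e"
    using assms x e unfolding continuous_on tendsto_iff by auto
  then show "\<forall>\<^sub>F y in at x within S. dist (c * f y) (c * f x) < e"
    by eventually_elim (use dist_mult le_less_trans in blast)
qed

section \<open>Endomorphisms of the lattice complex\<close>

text \<open>
  All operators below are finite sums of maps of this shape: each coordinate of the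
  output is a fixed multiple of a single coordinate of the input. Addition and
  multiplication of power series are continuous, so such sums are continuous endomorphisms.
\<close>

lemma CF_endomorphism_weighted_shift:
  assumes "\<And>K E. K \<notin> Char G \<Longrightarrow> c (K, E) = 0 \<or> fst (s (K, E)) \<notin> Char G"
  shows "CF_endomorphism G (\<lambda>x p. c p * x (s p))"
  unfolding CF_endomorphism_def
proof (intro conjI ballI allI)
  show "(\<lambda>x p. c p * x (s p)) ` CF G \<subseteq> CF G"
  proof (clarsimp simp: CF_def)
    fix x :: "'a chain" and K E
    assume "\<forall>K. K \<notin> Char G \<longrightarrow> (\<forall>E. x (K, E) = 0)" "K \<notin> Char G" "x (s (K, E)) \<noteq> 0"
    then show "c (K, E) = 0"
      using assms[of K E] by (cases "s (K, E)") auto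
  qed
  show "continuous_on (CF G) (\<lambda>x p. c p * x (s p))"
    by (intro continuous_on_coordinatewise_then_product continuous_on_fps_mult_left
        continuous_on_product_coordinates continuous_on_subset[OF continuous_on_product_coordinates]) auto
qed (auto simp: scale_def fun_eq_iff algebra_simps)

lemma CF_endomorphism_add:
  assumes "CF_endomorphism G \<Phi>" "CF_endomorphism G \<Psi>"
  shows "CF_endomorphism G (\<lambda>x. \<Phi> x + \<Psi> x)"
proof -
  have "continuous_on (CF G) (\<lambda>x p. \<Phi> x p + \<Psi> x p)"
    using assms unfolding CF_endomorphism_def
    by (intro continuous_on_coordinatewise_then_product continuous_on_fps_add)
       (auto intro: continuous_on_product_then_coordinatewise)
  then have "continuous_on (CF G) (\<lambda>x. \<Phi> x + \<Psi> x)"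
    by (simp add: plus_fun_def)
  moreover have "x + y \<in> CF G" if "x \<in> CF G" "y \<in> CF G" for x y
    using that by (simp add: CF_def)
  moreover have "scale c (x + y) = scale c x + scale c y" for c and x y :: "'a chain"
    by (simp add: scale_def fun_eq_iff distrib_left)
  ultimately show ?thesis
    using assms unfolding CF_endomorphism_def by (auto simp: image_subset_iff ac_simps)
qed

lemma CF_endomorphism_sum:
  assumes "finite A" "\<And>i. i \<in> A \<Longrightarrow> CF_endomorphism G (\<Phi> i)"
  shows "CF_endomorphism G (\<lambda>x. \<Sum>i\<in>A. \<Phi> i x)"
  using assms
proof (induction A rule: finite_induct)
  case empty
  show ?case
    using CF_endomorphism_weighted_shift[of G "\<lambda>_. 0" id] by (simp add: zero_fun_def)
qed (simp add: CF_endomorphism_add)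

section \<open>Coordinates of the differential\<close>

text \<open>The counterpart of \<^const>\<open>meridian_action\<close> for the second sum in the differential.\<close>

definition flip_action :: "'v::finite weighted_graph \<Rightarrow> 'v \<Rightarrow> 'v chain \<Rightarrow> 'v chain" where
  "flip_action G v = extend (\<lambda>K E.
     if v \<in> E then scale (fps_X ^ b_exp G v K E) (generator (K + 2 *s vertex_dual G v) (E - {v})) else 0)"

text \<open>
  The condition for \<^const>\<open>extend\<close> to be meaningful. It makes \<^const>\<open>extend\<close> additive in the map on
  generators even when coefficients cancel: cancellation shrinks the support over which
  \<^const>\<open>extend\<close> sums, but every sum may be taken over a common finite set.
\<close>

definition locally_finite :: "(int ^ 'v \<Rightarrow> 'v set \<Rightarrow> 'v::finite chain) \<Rightarrow> bool" where
  "locally_finite \<phi> \<longleftrightarrow> (\<forall>p. finite {(K, E). \<phi> K E p \<noteq> 0})"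

lemma extend_eq_sum:
  assumes "finite S" "{(K, E). \<phi> K E p \<noteq> 0} \<subseteq> S"
  shows "extend \<phi> x p = (\<Sum>(K, E)\<in>S. x (K, E) * \<phi> K E p)"
  unfolding extend_def using assms by (intro sum.mono_neutral_left) auto

lemma locally_finite_add:
  assumes "locally_finite \<phi>" "locally_finite \<psi>"
  shows "locally_finite (\<lambda>K E. \<phi> K E + \<psi> K E)"
  unfolding locally_finite_def
proof
  fix p
  have "finite ({(K, E). \<phi> K E p \<noteq> 0} \<union> {(K, E). \<psi> K E p \<noteq> 0})"
    using assms unfolding locally_finite_def by blast
  then show "finite {(K, E). (\<phi> K E + \<psi> K E) p \<noteq> 0}"
    by (rule finite_subset[rotated]) auto
qed

lemma extend_add:
  assumes "locally_finite \<phi>" "locally_finite \<psi>"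
  shows "extend (\<lambda>K E. \<phi> K E + \<psi> K E) x = extend \<phi> x + extend \<psi> x"
proof
  fix p
  let ?S = "{(K, E). \<phi> K E p \<noteq> 0} \<union> {(K, E). \<psi> K E p \<noteq> 0}"
  have fin: "finite ?S" using assms unfolding locally_finite_def by blast
  show "extend (\<lambda>K E. \<phi> K E + \<psi> K E) x p = (extend \<phi> x + extend \<psi> x) p"
    unfolding plus_fun_apply
    by (subst (1 2 3) extend_eq_sum[OF fin]) (auto simp: sum.distrib[symmetric] distrib_left case_prod_unfold)
qed

lemma extend_sum:
  assumes "finite A" "\<And>i. i \<in> A \<Longrightarrow> locally_finite (\<phi> i)"
  shows "locally_finite (\<lambda>K E. \<Sum>i\<in>A. \<phi> i K E) \<and>
    extend (\<lambda>K E. \<Sum>i\<in>A. \<phi> i K E) x = (\<Sum>i\<in>A. extend (\<phi> i) x)"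
  using assms
proof (induction A rule: finite_induct)
  case empty
  show ?case by (simp add: locally_finite_def extend_def zero_fun_def)
qed (simp add: extend_add locally_finite_add)

lemma remove_vertex_support:
  "{(K, E). (if v \<in> E then scale (c K E) (generator (K + t) (E - {v})) else 0) (K', E') \<noteq> 0}
    \<subseteq> {(K' - t, insert v E')}"
  by (auto simp: scale_def generator_def split: if_splits)

lemma locally_finite_remove_vertex:
  "locally_finite (\<lambda>K E. if v \<in> E then scale (c K E) (generator (K + t) (E - {v})) else 0)"
    (is "locally_finite ?\<phi>")
proof -
  have "finite {(K, E). ?\<phi> K E (K', E') \<noteq> 0}" for K' E'
    by (rule finite_subset[OF remove_vertex_support]) simp
  then show ?thesis
    unfolding locally_finite_def by (simp only: split_paired_All) blast
qed

lemma extend_remove_vertex: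
  "extend (\<lambda>K E. if v \<in> E then scale (c K E) (generator (K + t) (E - {v})) else 0) x (K, E)
    = (if v \<notin> E then c (K - t) (insert v E) * x (K - t, insert v E) else 0)"
    (is "extend ?\<phi> x _ = _")
proof -
  have "extend ?\<phi> x (K, E) = (\<Sum>(K', E')\<in>{(K - t, insert v E)}. x (K', E') * ?\<phi> K' E' (K, E))"
    by (rule extend_eq_sum, simp, rule remove_vertex_support)
  then show ?thesis
    by (auto simp: scale_def generator_def mult.commute)
qed

lemma meridian_action_apply:
  "meridian_action G v x (K, E)
    = (if v \<notin> E then fps_X ^ a_exp G v K (insert v E) * x (K, insert v E) else 0)"
  using extend_remove_vertex[of v "\<lambda>K E. fps_X ^ a_exp G v K E" 0 x K E]
  by (simp add: meridian_action_def cong: if_cong)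

lemma flip_action_apply:
  "flip_action G v x (K, E) =
    (if v \<notin> E then fps_X ^ b_exp G v (K - 2 *s vertex_dual G v) (insert v E)
        * x (K - 2 *s vertex_dual G v, insert v E) else 0)"
  unfolding flip_action_def by (rule extend_remove_vertex)

lemma differential_eq_sum:
  "differential G x = (\<Sum>v\<in>UNIV. meridian_action G v x) + (\<Sum>v\<in>UNIV. flip_action G v x)"
proof -
  let ?a = "\<lambda>v K E. if v \<in> E then scale (fps_X ^ a_exp G v K E) (generator K (E - {v})) else 0"
  let ?b = "\<lambda>v K E. if v \<in> E
    then scale (fps_X ^ b_exp G v K E) (generator (K + 2 *s vertex_dual G v) (E - {v})) else 0"
  have a: "locally_finite (?a v)" for v
    using locally_finite_remove_vertex[of v "\<lambda>K E. fps_X ^ a_exp G v K E" 0]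
    by (simp cong: if_cong)
  have b: "locally_finite (?b v)" for v
    by (rule locally_finite_remove_vertex)
  have "differential G = extend (\<lambda>K E. (\<Sum>v\<in>UNIV. ?a v K E) + (\<Sum>v\<in>UNIV. ?b v K E))"
    by (simp add: differential_def sum.If_cases)
  then show ?thesis
    using extend_sum[of UNIV ?a x] extend_sum[of UNIV ?b x] a b
    by (simp add: extend_add meridian_action_def flip_action_def)
qed

lemma sum_fun_apply: "(\<Sum>i\<in>A. f i) x = (\<Sum>i\<in>A. f i x)"
  by (induction A rule: infinite_finite_induct) simp_all

lemma meridian_action_add: "meridian_action G v (x + y) = meridian_action G v x + meridian_action G v y"
  by (auto simp: fun_eq_iff meridian_action_apply distrib_left)

lemma flip_action_add: "flip_action G v (x + y) = flip_action G v x + flip_action G v y"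
  by (auto simp: fun_eq_iff flip_action_apply distrib_left)

lemma homology_action_apply:
  "homology_action G \<gamma> x p = (\<Sum>v\<in>UNIV. of_int (\<gamma> $ v) * meridian_action G v x p)"
  by (simp add: homology_action_def scale_def sum_fun_apply)

lemma differential_apply:
  "differential G x p = (\<Sum>v\<in>UNIV. meridian_action G v x p) + (\<Sum>v\<in>UNIV. flip_action G v x p)"
  by (simp add: differential_eq_sum sum_fun_apply)

section \<open>The actions are chain maps\<close>

lemma meridian_action_commute:
  "meridian_action G v (meridian_action G w x) = meridian_action G w (meridian_action G v x)"
proof (cases "v = w")
  case False
  show ?thesis
  proof (rule ext, clarify)
    fix K E
    show "meridian_action G v (meridian_action G w x) (K, E)
        = meridian_action G w (meridian_action G v x) (K, E)"
    proof (cases "v \<in> E \<or> w \<in> E")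
      case outside: False
      have "insert v (insert w E) - {w} = insert v E" "insert v (insert w E) - {v} = insert w E"
        using outside False by auto
      then have "a_exp G v K (insert v E) + a_exp G w K (insert v (insert w E))
          = a_exp G w K (insert w E) + a_exp G v K (insert v (insert w E))"
        using a_exp_commute[of G v K "insert v (insert w E)" w] by simp
      then show ?thesis
        using outside False
        by (simp add: meridian_action_apply insert_commute flip: mult.assoc power_add)
    qed (use False in \<open>auto simp: meridian_action_apply\<close>)
  qed
qed simp

text \<open>
  Unlike the commutation of the \<open>A\<close>-terms, this needs the chain to be supported on
  \<open>Char(G)\<close>, where the formula for \<open>b\<^sub>w\<close> is available.
\<close>

lemma meridian_flip_commute:
  assumes G: "weighted_tree G" and x: "x \<in> CF G"
  shows "meridian_action G v (flip_action G w x) = flip_action G w (meridian_action G v x)"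
proof (rule ext, clarify)
  fix K E
  let ?K = "K - 2 *s vertex_dual G w"
  show "meridian_action G v (flip_action G w x) (K, E) = flip_action G w (meridian_action G v x) (K, E)"
  proof (cases "v \<in> E \<or> w \<in> E \<or> v = w \<or> ?K \<notin> Char G")
    case True
    then show ?thesis
      using x by (auto simp: meridian_action_apply flip_action_apply CF_def)
  next
    case False
    let ?E = "insert v (insert w E)"
    have "?E - {w} = insert v E" "?E - {v} = insert w E"
      using False by auto
    then have "a_exp G v K (insert v E) + b_exp G w ?K ?E = b_exp G w ?K (insert w E) + a_exp G v ?K ?E"
      using False a_exp_b_exp_commute[OF G, of ?K w ?E v] by simp
    then show ?thesis
      using False
      by (auto simp: meridian_action_apply flip_action_apply insert_commute simp flip: mult.assoc power_add)
  qed
qed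

lemma meridian_action_sum: "meridian_action G v (\<Sum>i\<in>A. x i) = (\<Sum>i\<in>A. meridian_action G v (x i))"
  by (auto simp: fun_eq_iff meridian_action_apply sum_fun_apply sum_distrib_left)

lemma differential_meridian_action:
  assumes "weighted_tree G" "x \<in> CF G"
  shows "differential G (meridian_action G v x) = meridian_action G v (differential G x)"
  using meridian_flip_commute[OF assms] meridian_action_commute[of G v]
  by (simp add: differential_eq_sum meridian_action_add meridian_action_sum)

lemma differential_homology_action:
  assumes "weighted_tree G" "x \<in> CF G"
  shows "differential G (homology_action G \<gamma> x) = homology_action G \<gamma> (differential G x)"
proof -
  have scale: "differential G (scale c y) = scale c (differential G y)" for c y
    by (auto simp: fun_eq_iff differential_apply scale_def meridian_action_apply flip_action_apply
        sum_distrib_left distrib_left mult.left_commute intro!: arg_cong2[of _ _ _ _ "(+)"] sum.cong)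
  have add: "differential G (y + z) = differential G y + differential G z" for y z
    by (simp add: differential_eq_sum meridian_action_add flip_action_add sum.distrib)
  have zero: "differential G 0 = 0"
    using scale[of 0 0] by (simp add: scale_def zero_fun_def)
  have "differential G (\<Sum>v\<in>A. y v) = (\<Sum>v\<in>A. differential G (y v))" if "finite A" for A :: "'a set" and y
    using that by induction (simp_all only: sum.empty sum.insert zero add not_False_eq_True)
  then show ?thesis
    by (simp add: homology_action_def scale differential_meridian_action[OF assms])
qed

lemma chain_map_homology_action:
  assumes "weighted_tree G"
  shows "chain_map G (homology_action G \<gamma>)"
  unfolding chain_map_def
proof (intro conjI ballI)
  let ?c = "\<lambda>v (K, E). if v \<notin> E then of_int (\<gamma> $ v) * fps_X ^ a_exp G v K (insert v E) else 0"
  let ?s = "\<lambda>v (K, E). (K, insert v E)"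
  have "CF_endomorphism G (\<lambda>x. \<Sum>v\<in>UNIV. (\<lambda>p. ?c v p * x (?s v p)))"
    by (intro CF_endomorphism_sum CF_endomorphism_weighted_shift) auto
  moreover have "homology_action G \<gamma> = (\<lambda>x. \<Sum>v\<in>UNIV. (\<lambda>p. ?c v p * x (?s v p)))"
    by (auto simp: fun_eq_iff homology_action_apply meridian_action_apply sum_fun_apply mult.assoc
        intro!: sum.cong)
  ultimately show "CF_endomorphism G (homology_action G \<gamma>)" by simp
qed (rule differential_homology_action[OF assms])

section \<open>Torsion classes and potentials\<close>

text \<open>
  The passage from the two successive quotients to a statement about vectors: the
  class of \<open>\<gamma>\<close> is that of \<open>\<tau> + \<gamma>'\<close> with \<open>\<tau>\<close> representing a torsion element of \<open>H\<^sub>1\<close>.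
\<close>

lemma multiple_in_relations:
  fixes G :: "'v::finite weighted_graph"
  assumes eq: "H1_mod_torsion_class G \<gamma> = H1_mod_torsion_class G \<gamma>'"
  obtains n :: nat and c where "0 < n" "int n *s (\<gamma> - \<gamma>') = framing_matrix G *v c"
proof -
  let ?M = "meridian_group :: (int ^ 'v) monoid"
  let ?R = "relations G"
  let ?cos = "\<lambda>\<delta>. ?R #>\<^bsub>?M\<^esub> \<delta>"
  have M [simp]: "carrier ?M = UNIV" "\<one>\<^bsub>?M\<^esub> = 0" "x \<otimes>\<^bsub>?M\<^esub> y = x + y" for x y
    by (simp_all add: meridian_group_def)
  interpret M: comm_group ?M
    by (rule comm_groupI) (auto simp: ac_simps intro!: exI[of _ "- _"])
  have inv: "inv\<^bsub>?M\<^esub> x = - x" for x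
    by (rule M.inv_equality) simp_all
  have "subgroup ?R ?M"
  proof
    show "x \<otimes>\<^bsub>?M\<^esub> y \<in> ?R" if xy: "x \<in> ?R" "y \<in> ?R" for x y
    proof -
      from xy obtain s t where "x = framing_matrix G *v s" "y = framing_matrix G *v t"
        by (auto simp: relations_def)
      then show ?thesis by (simp add: relations_def flip: matrix_vector_right_distrib)
    qed
    show "\<one>\<^bsub>?M\<^esub> \<in> ?R"
      by (auto simp: relations_def intro!: image_eqI[of _ _ 0])
    show "inv\<^bsub>?M\<^esub> x \<in> ?R" if x: "x \<in> ?R" for x
    proof -
      from x obtain s where "x = framing_matrix G *v s" by (auto simp: relations_def)
      then have "- x = framing_matrix G *v (- s)"
        by (simp add: vec_eq_iff matrix_vector_mult_def sum_negf)
      then show ?thesis by (simp add: relations_def inv)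
    qed
  qed simp
  then interpret R: normal ?R ?M
    by (simp add: M.normal_iff_subgroup)
  interpret Q: group "H1 G"
    unfolding H1_def by (rule R.factorgroup_is_group)
  have self: "\<delta> \<in> ?cos \<delta>" for \<delta>
    by (rule M.rcos_self[OF _ R.subgroup_axioms]) simp
  have cos: "?cos \<delta> \<in> carrier (H1 G)" for \<delta>
    by (simp add: H1_def carrier_FactGroup)
  have "\<one>\<^bsub>H1 G\<^esub> \<in> torsion (H1 G)"
    by (auto simp: torsion_def)
  then have "?cos \<gamma> \<in> H1_mod_torsion_class G \<gamma>"
    unfolding H1_mod_torsion_class_def r_coset_def[of "H1 G"] using Q.l_one[OF cos] by fastforce
  then obtain T where T: "T \<in> torsion (H1 G)" "?cos \<gamma> = T \<otimes>\<^bsub>H1 G\<^esub> ?cos \<gamma>'"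
    unfolding eq unfolding H1_mod_torsion_class_def r_coset_def[of "H1 G"] by blast
  then obtain n :: nat where n: "0 < n" "T [^]\<^bsub>H1 G\<^esub> n = ?R" and "T \<in> carrier (H1 G)"
    by (auto simp: torsion_def H1_def)
  then obtain \<tau> where \<tau>: "T = ?cos \<tau>"
    by (auto simp: H1_def carrier_FactGroup)
  have pow: "\<tau> [^]\<^bsub>?M\<^esub> k = int k *s \<tau>" for k :: nat
    by (induction k) (simp_all add: vec_eq_iff algebra_simps)
  have "?cos (int n *s \<tau>) = ?R"
    using n(2) R.FactGroup_pow[of \<tau> n] by (simp add: \<tau> H1_def pow)
  then have "int n *s \<tau> \<in> ?R"
    using self by metis
  then obtain t where t: "int n *s \<tau> = framing_matrix G *v t"
    by (auto simp: relations_def)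
  have "?cos \<gamma> = ?cos (\<tau> + \<gamma>')"
    using T(2) R.rcos_sum[of \<tau> \<gamma>'] by (simp add: \<tau> H1_def)
  then have "\<gamma> \<in> ?cos (\<tau> + \<gamma>')"
    using self by metis
  then obtain r where r: "\<gamma> = framing_matrix G *v r + (\<tau> + \<gamma>')"
    by (auto simp: r_coset_def relations_def)
  have "int n *s (\<gamma> - \<gamma>') = int n *s (framing_matrix G *v r) + int n *s \<tau>"
    by (simp add: r vec_eq_iff algebra_simps)
  also have "\<dots> = framing_matrix G *v (int n *s r + t)"
    by (simp add: t vec_eq_iff matrix_vector_mult_def sum.distrib sum_distrib_left algebra_simps)
  finally show ?thesis using n(1) that by blast
qed

text \<open>
  By symmetry the image of the framing matrix is orthogonal to its kernel, and since \<open>\<int>\<close> has no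
  zero divisors, orthogonality passes from the multiple \<open>n\<delta>\<close> to \<open>\<delta>\<close>. Hence torsion classes act
  like zero even when \<open>n\<close> is even.
\<close>

lemma evaluate_kernel_eq_0:
  assumes G: "weighted_tree G" and n: "0 < n" "int n *s \<delta> = framing_matrix G *v c"
    and m: "framing_matrix G *v m = 0"
  shows "evaluate \<delta> m = 0"
proof -
  let ?L = "\<lambda>v u. framing_matrix G $ v $ u"
  have "int n * evaluate \<delta> m = (\<Sum>v\<in>UNIV. (int n *s \<delta>) $ v * m $ v)"
    by (simp add: evaluate_def sum_distrib_left mult.assoc)
  also have "\<dots> = (\<Sum>v\<in>UNIV. \<Sum>w\<in>UNIV. ?L v w * c $ w * m $ v)"
    by (simp add: n(2) matrix_vector_mult_def sum_distrib_right)
  also have "\<dots> = (\<Sum>w\<in>UNIV. \<Sum>v\<in>UNIV. ?L w v * c $ w * m $ v)"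
    by (subst sum.swap) (simp add: framing_matrix_symmetric[OF G])
  also have "\<dots> = (\<Sum>w\<in>UNIV. c $ w * (framing_matrix G *v m) $ w)"
    by (simp add: matrix_vector_mult_def sum_distrib_left mult.left_commute mult.assoc)
  finally show ?thesis using n(1) m by simp
qed

text \<open>
  On the orbit of a base point \<open>B\<close> under translations by the vectors \<open>2v\<^sup>*\<close>, put
  \<open>k(B + 2\<Lambda>m) = \<delta> \<cdot> m\<close>. Two choices of \<open>m\<close> differ by an element of the kernel of \<open>\<Lambda>\<close>, so the
  hypothesis on \<open>\<delta>\<close> makes this well defined.
\<close>

lemma potential_exists:
  fixes G :: "'v::finite weighted_graph"
  assumes G: "weighted_tree G"
    and ker: "\<And>m. framing_matrix G *v m = 0 \<Longrightarrow> evaluate \<delta> m = 0"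
  obtains k :: "int ^ 'v \<Rightarrow> int" where "\<And>K v. k (K + 2 *s vertex_dual G v) = k K + \<delta> $ v"
proof -
  let ?L = "framing_matrix G"
  define orbit where "orbit K = {K + 2 *s (?L *v m) | m. True}" for K
  define base where "base K = (SOME B. B \<in> orbit K)" for K
  define pos where "pos K = (SOME m. K = base K + 2 *s (?L *v m))" for K
  define k where "k K = evaluate \<delta> (pos K)" for K
  have "base K \<in> orbit K" for K
    unfolding base_def by (rule someI[of _ K]) (auto simp: orbit_def intro!: exI[of _ 0])
  then have base: "\<exists>m. K = base K + 2 *s (?L *v m)" for K
  proof -
    from \<open>base K \<in> orbit K\<close> obtain m where "base K = K + 2 *s (?L *v m)"
      by (auto simp: orbit_def)
    moreover have "?L *v (- m) = - (?L *v m)"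
      by (simp add: vec_eq_iff matrix_vector_mult_def sum_negf)
    ultimately show ?thesis
      by (intro exI[of _ "- m"]) (simp add: vec_eq_iff)
  qed
  have pos: "K = base K + 2 *s (?L *v pos K)" for K
    unfolding pos_def by (rule someI_ex[OF base])
  have "k (K + 2 *s vertex_dual G v) = k K + \<delta> $ v" for K v
  proof -
    let ?K = "K + 2 *s vertex_dual G v"
    have dual: "vertex_dual G v = ?L *v axis v 1"
      using framing_matrix_symmetric[OF G]
      by (simp add: vec_eq_iff vertex_dual_nth matrix_vector_mult_def axis_def if_distrib cong: if_cong)
    \<comment> \<open>The base point depends on the orbit alone, so it is shared by \<open>K\<close> and \<open>K + 2v\<^sup>*\<close>.\<close>
    have "orbit ?K = orbit K"
    proof -
      have shift: "?K + 2 *s (?L *v m) = K + 2 *s (?L *v (m + axis v 1))" for m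
        by (simp add: dual matrix_vector_right_distrib vec_eq_iff)
      have "K + 2 *s (?L *v m) = ?K + 2 *s (?L *v (m - axis v 1))" for m
        using shift[of "m - axis v 1"] by simp
      with shift show ?thesis
        unfolding orbit_def by blast
    qed
    then have "base ?K = base K"
      by (simp add: base_def)
    then have double: "2 *s (?L *v pos ?K) = 2 *s (?L *v pos K) + 2 *s (?L *v axis v 1)"
      using pos[of K] pos[of ?K] by (simp add: dual vec_eq_iff)
    have eq: "?L *v pos ?K = ?L *v (pos K + axis v 1)"
      unfolding vec_eq_iff
    proof
      fix w
      show "(?L *v pos ?K) $ w = (?L *v (pos K + axis v 1)) $ w"
        using arg_cong[OF double, of "\<lambda>x. x $ w"] by (simp add: matrix_vector_right_distrib)
    qed
    have "?L *v (pos ?K - (pos K + axis v 1)) = 0"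
      using eq matrix_vector_right_distrib[of ?L "pos ?K - (pos K + axis v 1)" "pos K + axis v 1"]
      by simp
    then have "evaluate \<delta> (pos ?K - (pos K + axis v 1)) = 0"
      by (rule ker)
    moreover have "evaluate \<delta> (axis v 1) = \<delta> $ v"
      by (simp add: evaluate_def axis_def if_distrib cong: if_cong)
    ultimately show ?thesis
      by (simp add: k_def evaluate_def algebra_simps sum.distrib sum_subtractf)
  qed
  then show ?thesis by (rule that)
qed

section \<open>The homotopy\<close>

lemma bit_fps_diff_eq_add: "(a :: bit fps) - b = a + b"
  by (simp add: fps_eq_iff)

theorem lemma7p1:
  fixes G :: "'v::finite weighted_graph" and \<gamma> \<gamma>' :: "int ^ 'v"
  assumes "weighted_tree G"
    and "H1_mod_torsion_class G \<gamma> = H1_mod_torsion_class G \<gamma>'"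
  shows "chain_homotopic G (homology_action G \<gamma>) (homology_action G \<gamma>')"
proof -
  define \<delta> where "\<delta> = \<gamma> - \<gamma>'"
  obtain n :: nat and c where "0 < n" "int n *s \<delta> = framing_matrix G *v c"
    using multiple_in_relations[OF assms(2)] unfolding \<delta>_def .
  then obtain k :: "int ^ 'v \<Rightarrow> int" where k: "\<And>K v. k (K + 2 *s vertex_dual G v) = k K + \<delta> $ v"
    using potential_exists[OF assms(1)] evaluate_kernel_eq_0[OF assms(1)] by metis
  define h where "h = (\<lambda>(K, E). k K + (\<Sum>v\<in>E. \<delta> $ v))"
  define H :: "'v chain \<Rightarrow> 'v chain" where "H x = (\<lambda>p. of_int (h p) * x p)" for x
  have "CF_endomorphism G H"
    unfolding H_def using CF_endomorphism_weighted_shift[of G "\<lambda>p. of_int (h p)" "\<lambda>p. p"] by simp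
  moreover have "homology_action G \<gamma> x - homology_action G \<gamma>' x
      = differential G (H x) + H (differential G x)" for x
  proof (rule ext, clarify)
    fix K E
    have meridian: "meridian_action G v (H x) (K, E) + of_int (h (K, E)) * meridian_action G v x (K, E)
        = of_int (\<delta> $ v) * meridian_action G v x (K, E)" for v
    proof (cases "v \<in> E")
      case False
      then have "h (K, insert v E) - h (K, E) = \<delta> $ v"
        by (simp add: h_def)
      then have "of_int (\<delta> $ v) = (of_int (h (K, insert v E)) + of_int (h (K, E)) :: bit fps)"
        by (metis bit_fps_diff_eq_add of_int_diff)
      with False show ?thesis
        by (simp add: meridian_action_apply H_def algebra_simps)
    qed (simp add: meridian_action_apply)
    have flip: "flip_action G v (H x) (K, E) + of_int (h (K, E)) * flip_action G v x (K, E) = 0" for v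
    proof (cases "v \<in> E")
      case False
      then have "h (K - 2 *s vertex_dual G v, insert v E) = h (K, E)"
        using k[of "K - 2 *s vertex_dual G v" v] by (simp add: h_def)
      with False show ?thesis
        by (simp add: flip_action_apply H_def mult.left_commute flip: bit_fps_diff_eq_add)
    qed (simp add: flip_action_apply)
    have "(differential G (H x) + H (differential G x)) (K, E)
        = (\<Sum>v\<in>UNIV. meridian_action G v (H x) (K, E) + of_int (h (K, E)) * meridian_action G v x (K, E))
        + (\<Sum>v\<in>UNIV. flip_action G v (H x) (K, E) + of_int (h (K, E)) * flip_action G v x (K, E))"
      by (simp add: differential_apply H_def[of "differential G x"] sum.distrib sum_distrib_left distrib_left)
    also have "\<dots> = (\<Sum>v\<in>UNIV. of_int (\<delta> $ v) * meridian_action G v x (K, E))"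
      by (simp add: meridian flip)
    finally show "(homology_action G \<gamma> x - homology_action G \<gamma>' x) (K, E)
        = (differential G (H x) + H (differential G x)) (K, E)"
      by (simp add: homology_action_apply \<delta>_def left_diff_distrib sum_subtractf)
  qed
  ultimately show ?thesis
    unfolding chain_homotopic_def using chain_map_homology_action[OF assms(1)] by blast
qed

end
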